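(* Let $c_1,c_2,c_3$ and $d_1,d_2,d_3$ be complex numbers with $|c_j|^2+|d_j|^2\le1$ for $j=1,2,3$, and suppose that the complex numbers $\alpha,\beta$ satisfy $$|\alpha|^2|\gamma|^2+|\beta|^2|\delta|^2\le\max_{j=1,2,3}|\gamma c_j+\delta d_j|^2\qquad\text{for all }\gamma,\delta\in\mathbb{C}.$$ Then $|\alpha|^2+|\beta|^2\le1$. *)

theory Defs
  imports Complex_Main
begin

end

theory Submission
  imports Defs "HOL-Analysis.Analysis"
begin

text \<open>
  Put \<open>a = |\<alpha>|\<^sup>2\<close>, \<open>b = |\<beta>|\<^sup>2\<close>, \<open>t = a + b\<close>. Parametrise the unit vectors \<open>(\<gamma>, \<delta>)\<close>, up to phase, by the
  points \<open>n\<close> of the Bloch sphere in \<open>\<real>\<^sup>3\<close>. The condition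
  \<open>|\<gamma> c + \<delta> d|\<^sup>2 \<le> (a |\<gamma>|\<^sup>2 + b |\<delta>|\<^sup>2) / t\<close> is affine in \<open>n\<close>, and since both sides come from Hermitian
  forms with traces \<open>|c|\<^sup>2 + |d|\<^sup>2 \<le> 1\<close> and \<open>1\<close>, it is implied by a homogeneous condition
  \<open>u \<bullet> n \<le> 0\<close>. Three closed half-spaces through the origin of \<open>\<real>\<^sup>3\<close> always have a common
  nonzero point, so one \<open>(\<gamma>, \<delta>)\<close> serves all three indices, and the hypothesis at this point
  gives \<open>t \<le> 1\<close>.
\<close>

text \<open>With as many vectors as dimensions, \<open>f\<close> is an endomorphism: either it is
  onto and attains the vector with all entries -1, or it has a nonzero kernel vector, which gives
  equality throughout. Normalising keeps the signs.\<close>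

lemma common_point_of_halfspaces:
  fixes u :: "'n::finite \<Rightarrow> real ^ 'n"
  shows "\<exists>n. norm n = 1 \<and> (\<forall>j. u j \<bullet> n \<le> 0)"
proof -
  define f where "f n = (\<chi> j. u j \<bullet> n)" for n
  have lin: "linear f"
    by (rule linearI) (simp_all add: f_def vec_eq_iff inner_add_right)
  obtain n where n: "n \<noteq> 0" "\<And>j. u j \<bullet> n \<le> 0"
  proof (cases "inj f")
    case True
    then have "surj f"
      using lin linear_injective_imp_surjective by blast
    then obtain n where "f n = (\<chi> j. -1)"
      by (metis surjD)
    then have n: "u j \<bullet> n = -1" for j
      by (simp add: f_def vec_eq_iff)
    then have "n \<noteq> 0"
      by force
    with n show ?thesis
      by (intro that[of n]) auto
  next
    case False
    then obtain n where "f n = 0" "n \<noteq> 0"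
      using lin linear_injective_0 by blast
    then show ?thesis
      by (intro that[of n]) (auto simp: f_def vec_eq_iff)
  qed
  then have "norm (n /\<^sub>R norm n) = 1" "\<And>j. u j \<bullet> (n /\<^sub>R norm n) \<le> 0"
    by (auto simp: mult_nonneg_nonpos)
  then show ?thesis
    by blast
qed

text \<open>Surjectivity of the Hopf map. The free phase lets \<gamma> be real and nonnegative; then
  \<open>z\<close> determines \<delta>, except at the pole \<open>h = -1\<close>, where \<gamma>
  vanishes.\<close>

lemma bloch_sphere_point:
  fixes h :: real and z :: complex
  assumes "h\<^sup>2 + (cmod z)\<^sup>2 = 1"
  obtains \<gamma> \<delta> where "(cmod \<gamma>)\<^sup>2 = (1 + h) / 2" "(cmod \<delta>)\<^sup>2 = (1 - h) / 2" "2 * (\<gamma> * cnj \<delta>) = z"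
proof (cases "h = -1")
  case True
  with assms have "z = 0" by simp
  with True show ?thesis
    by (intro that[of 0 1]) auto
next
  case False
  have "h\<^sup>2 \<le> 1" using assms by (smt (verit) zero_le_power2)
  then have "-1 \<le> h" by (simp add: abs_square_le_1 abs_le_iff)
  with False have h: "1 + h > 0" by simp
  define g where "g = sqrt ((1 + h) / 2)"
  have g: "g > 0" "g\<^sup>2 = (1 + h) / 2"
    using h by (auto simp: g_def)
  have "(cmod (cnj z / (2 * of_real g)))\<^sup>2 = (1 - h\<^sup>2) / (4 * g\<^sup>2)"
    using assms g by (simp add: norm_divide norm_mult power_divide power_mult_distrib)
  also have "\<dots> = (1 - h) / 2"
    using h unfolding g(2) by (simp add: field_simps power2_eq_square)
  finally show ?thesis
    using g by (intro that[of "of_real g" "cnj z / (2 * of_real g)"]) auto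
qed

lemma cmod_sum_mult_squared:
  "(cmod (\<gamma> * c + \<delta> * d))\<^sup>2 =
     (cmod \<gamma>)\<^sup>2 * (cmod c)\<^sup>2 + (cmod \<delta>)\<^sup>2 * (cmod d)\<^sup>2 + Re (2 * (\<gamma> * cnj \<delta>) * (c * cnj d))"
  unfolding cmod_power2 by (simp add: power2_eq_square algebra_simps)

lemma common_bounded_direction:
  fixes c d :: "3 \<Rightarrow> complex" and p q :: real
  assumes "p + q = 1" and "\<And>j. (cmod (c j))\<^sup>2 + (cmod (d j))\<^sup>2 \<le> 1"
  obtains \<gamma> \<delta> where "(cmod \<gamma>)\<^sup>2 + (cmod \<delta>)\<^sup>2 = 1"
    "\<And>j. (cmod (\<gamma> * c j + \<delta> * d j))\<^sup>2 \<le> p * (cmod \<gamma>)\<^sup>2 + q * (cmod \<delta>)\<^sup>2"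
proof -
  define w where "w j = c j * cnj (d j)" for j
  \<comment> \<open>Chosen so that for \<open>n = (h, Re z, Im z)\<close> the product
    \<open>u j \<bullet> n\<close> is \<open>h\<close> times the first entry plus
    \<open>2 * Re (z * w j)\<close>.\<close>
  define u :: "3 \<Rightarrow> real ^ 3"
    where "u j = vector [(cmod (c j))\<^sup>2 - (cmod (d j))\<^sup>2 - (p - q), 2 * Re (w j), -2 * Im (w j)]" for j
  obtain n where n: "norm n = 1" "\<And>j. u j \<bullet> n \<le> 0"
    using common_point_of_halfspaces[of u] by blast
  define h where "h = n $ 1"
  define z where "z = Complex (n $ 2) (n $ 3)"
  have "n \<bullet> n = 1"
    using n(1) by (simp add: dot_square_norm)
  then have "h\<^sup>2 + (cmod z)\<^sup>2 = 1"
    unfolding cmod_power2 by (simp add: inner_vec_def sum_3 h_def z_def power2_eq_square)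
  then obtain \<gamma> \<delta> where gd: "(cmod \<gamma>)\<^sup>2 = (1 + h) / 2" "(cmod \<delta>)\<^sup>2 = (1 - h) / 2" "2 * (\<gamma> * cnj \<delta>) = z"
    by (rule bloch_sphere_point)
  show ?thesis
  proof
    show "(cmod \<gamma>)\<^sup>2 + (cmod \<delta>)\<^sup>2 = 1"
      by (simp add: gd field_simps)
    fix j
    have q: "q = 1 - p" using assms(1) by simp
    have "h * ((cmod (c j))\<^sup>2 - (cmod (d j))\<^sup>2 - (p - q)) + 2 * Re (z * w j) \<le> 0"
      using n(2)[of j]
      by (simp add: u_def inner_vec_def sum_3 h_def z_def algebra_simps)
    \<comment> \<open>Doubled, the two sides are \<open>|c|\<^sup>2 + |d|\<^sup>2 + h * (|c|\<^sup>2
      - |d|\<^sup>2) + 2 * Re (z * w)\<close> and \<open>1 + h * (p - q)\<close>.\<close>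
    with assms(2)[of j]
    show "(cmod (\<gamma> * c j + \<delta> * d j))\<^sup>2 \<le> p * (cmod \<gamma>)\<^sup>2 + q * (cmod \<delta>)\<^sup>2"
      unfolding cmod_sum_mult_squared gd w_def[symmetric] q
      by (simp add: field_simps)
  qed
qed

theorem proposition4p5:
  fixes c d :: "nat \<Rightarrow> complex" and \<alpha> \<beta> :: complex
  assumes "\<forall>j\<in>{1,2,3}. (cmod (c j))\<^sup>2 + (cmod (d j))\<^sup>2 \<le> 1"
    and "\<forall>\<gamma> \<delta> :: complex.
           (cmod \<alpha>)\<^sup>2 * (cmod \<gamma>)\<^sup>2 + (cmod \<beta>)\<^sup>2 * (cmod \<delta>)\<^sup>2
             \<le> (MAX j\<in>{1,2,3}. (cmod (\<gamma> * c j + \<delta> * d j))\<^sup>2)"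
  shows "(cmod \<alpha>)\<^sup>2 + (cmod \<beta>)\<^sup>2 \<le> 1"
proof (rule ccontr)
  define a where "a = (cmod \<alpha>)\<^sup>2"
  define b where "b = (cmod \<beta>)\<^sup>2"
  assume "\<not> ?thesis"
  then have t: "a + b > 1" by (simp add: a_def b_def)
  have bound: "a * (cmod \<gamma>)\<^sup>2 + b * (cmod \<delta>)\<^sup>2 \<le> M"
    if "\<And>j. j \<in> {1,2,3} \<Longrightarrow> (cmod (\<gamma> * c j + \<delta> * d j))\<^sup>2 \<le> M" for \<gamma> \<delta> M
  proof -
    have "(MAX j\<in>{1,2,3}. (cmod (\<gamma> * c j + \<delta> * d j))\<^sup>2) \<le> M"
      using that by (subst Max_le_iff) auto
    then show ?thesis
      using assms(2) order_trans unfolding a_def b_def by blast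
  qed
  have cd: "(cmod (c j))\<^sup>2 \<le> 1" "(cmod (d j))\<^sup>2 \<le> 1" if "j \<in> {1,2,3}" for j
    using assms(1)[rule_format, OF that] zero_le_power2[of "cmod (c j)"] zero_le_power2[of "cmod (d j)"]
    by linarith+
  \<comment> \<open>Testing the coordinate vectors; with \<open>a + b > 1\<close> this makes both
    weights positive, hence \<open>m > 0\<close> below.\<close>
  have "a \<le> 1" "b \<le> 1"
    using bound[of 1 0 1] bound[of 0 1 1] cd by simp_all
  with t have pos: "a > 0" "b > 0" by linarith+
  \<comment> \<open>Transfers the natural indices to the three-element type
    \<open>3\<close>.\<close>
  define e :: "3 \<Rightarrow> nat" where "e j = (if j = 1 then 1 else if j = 2 then 2 else 3)" for j
  have e: "e j \<in> {1,2,3}" "e 1 = 1" "e 2 = 2" "e 3 = 3" for j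
    by (auto simp: e_def)
  have "a / (a + b) + b / (a + b) = 1"
    using t by (simp flip: add_divide_distrib)
  then obtain \<gamma> \<delta> where gd: "(cmod \<gamma>)\<^sup>2 + (cmod \<delta>)\<^sup>2 = 1"
    "\<And>j. (cmod (\<gamma> * c (e j) + \<delta> * d (e j)))\<^sup>2 \<le> a / (a + b) * (cmod \<gamma>)\<^sup>2 + b / (a + b) * (cmod \<delta>)\<^sup>2"
    using common_bounded_direction[of "a / (a + b)" "b / (a + b)" "c \<circ> e" "d \<circ> e"] assms(1) e(1)
    by (metis comp_apply)
  define m where "m = a * (cmod \<gamma>)\<^sup>2 + b * (cmod \<delta>)\<^sup>2"
  have "(cmod (\<gamma> * c j + \<delta> * d j))\<^sup>2 \<le> m / (a + b)" if "j \<in> {1,2,3}" for j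
    using that gd(2)[of 1] gd(2)[of 2] gd(2)[of 3] by (auto simp: e m_def add_divide_distrib)
  then have "m \<le> m / (a + b)"
    unfolding m_def by (rule bound)
  moreover have "m > 0"
  proof -
    have "(cmod \<gamma>)\<^sup>2 > 0 \<or> (cmod \<delta>)\<^sup>2 > 0"
      using gd(1) by (smt (verit))
    then show ?thesis
      unfolding m_def using pos
      by (auto intro: add_pos_nonneg add_nonneg_pos)
  qed
  ultimately have "m * (a + b) \<le> m * 1"
    using t by (simp add: pos_le_divide_eq)
  with \<open>m > 0\<close> t show False
    by (simp only: mult_le_cancel_left_pos)
qed

end
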